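(* The presentation $\langle x,y \mid x^3=y^4,\ xyx=yxy\rangle$ is stably AC-equivalent to the presentation $\langle x,y \mid x^4 = y x^2 y^{-1} x^{-1} y x^2 y^{-1},\ y=[x^2,y]^3\rangle$.
   Context: Commutator notation: $[a,b]=aba^{-1}b^{-1}$. For a tuple $Y=(y_1,\dots,y_m)$ of elements of a free group $F$, consider the transformations: (AC1) replace $y_i$ by $y_iy_j$ for some $j\ne i$; (AC2) replace $y_i$ by $y_i^{-1}$; (AC3) replace $y_i$ by $g y_i g^{-1}$ for some $g\in F$ (all other entries unchanged); (AC4) extend $Y$ to $(y_1,\dots,y_m,x_\nu)$, where $x_\nu$ is a new free generator (the ambient free group is enlarged by the free generator $x_\nu$, and $y_1,\dots,y_m$ do not involve $x_\nu$); (AC5) the converse of (AC4), for any free generator $x_\nu$ of the ambient free group that is an entry of the tuple and is not involved in the other entries. Two tuples are stably AC-equivalent if one can be obtained from the other by a finite sequence of transformations (AC1)-(AC5). Two presentations are stably AC-equivalent if their tuples of relators are; as usual, the names of the free generators are immaterial. A relation $u=v$ in a presentation stands for the relator $uv^{-1}$. *)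

theory Defs
  imports "HOL-Algebra.Group"
begin

section \<open>Free groups as groups of reduced words\<close>

text \<open>The letter \<open>(a, True)\<close> stands for the generator \<open>a\<close>, and \<open>(a, False)\<close> for its inverse.\<close>

type_synonym 'a word = "('a \<times> bool) list"

definition inv_letter :: "'a \<times> bool \<Rightarrow> 'a \<times> bool" where
  "inv_letter l = (fst l, \<not> snd l)"

fun reduced :: "'a word \<Rightarrow> bool" where
  "reduced [] \<longleftrightarrow> True"
| "reduced [l] \<longleftrightarrow> True"
| "reduced (l # k # w) \<longleftrightarrow> k \<noteq> inv_letter l \<and> reduced (k # w)"

fun push :: "'a \<times> bool \<Rightarrow> 'a word \<Rightarrow> 'a word" where
  "push l [] = [l]"
| "push l (k # w) = (if k = inv_letter l then w else l # k # w)"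

definition reduce :: "'a word \<Rightarrow> 'a word" where
  "reduce w = foldr push w []"

definition free_group :: "'a set \<Rightarrow> 'a word monoid" where
  "free_group S =
    \<lparr>carrier = {w. reduced w \<and> fst ` set w \<subseteq> S}, mult = (\<lambda>u v. reduce (u @ v)), one = []\<rparr>"

definition gen :: "'a \<Rightarrow> 'a word" where
  "gen a = [(a, True)]"

lemma inv_letter_invol [simp]: "inv_letter (inv_letter l) = l"
  by (simp add: inv_letter_def)

lemma reduced_tl: "reduced (l # w) \<Longrightarrow> reduced w"
  by (cases w) auto

lemma reduced_push: "reduced w \<Longrightarrow> reduced (push l w)"
  by (cases w) (auto dest: reduced_tl)

lemma reduced_foldr_push: "reduced v \<Longrightarrow> reduced (foldr push u v)"
  by (induction u) (auto intro: reduced_push)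

lemma push_push_inv:
  assumes "reduced w" shows "push l (push (inv_letter l) w) = w"
proof (cases w)
  case Nil
  then show ?thesis by simp
next
  case (Cons k v)
  show ?thesis
  proof (cases "k = l")
    case True
    with Cons assms show ?thesis by (cases v) auto
  next
    case False
    with Cons show ?thesis by simp
  qed
qed

lemma foldr_push_push:
  assumes "reduced w" shows "foldr push (push l t) w = push l (foldr push t w)"
proof (cases t)
  case (Cons k t')
  then show ?thesis
    using push_push_inv[OF reduced_foldr_push[OF assms, of t'], of l] by simp
qed simp

lemma foldr_push_assoc:
  assumes "reduced w"
  shows "foldr push (foldr push u v) w = foldr push u (foldr push v w)"
  by (induction u) (simp_all add: foldr_push_push assms)

lemma reduce_reduced: "reduced w \<Longrightarrow> reduce w = w"
proof (induction w)
  case (Cons l w)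
  then have "reduce w = w" using reduced_tl by blast
  then show ?case using Cons.prems unfolding reduce_def by (cases w) auto
qed (simp add: reduce_def)

lemma reduce_append: "reduced v \<Longrightarrow> reduce (u @ v) = foldr push u v"
  using reduce_reduced[of v] by (simp add: reduce_def)

lemma gens_push: "fst ` set (push l w) \<subseteq> insert (fst l) (fst ` set w)"
  by (cases w) auto

lemma gens_foldr_push: "fst ` set (foldr push u v) \<subseteq> fst ` set u \<union> fst ` set v"
proof (induction u)
  case (Cons l u)
  have "fst ` set (push l (foldr push u v)) \<subseteq> insert (fst l) (fst ` set (foldr push u v))"
    by (rule gens_push)
  also have "\<dots> \<subseteq> insert (fst l) (fst ` set u \<union> fst ` set v)"
    using Cons.IH by (rule insert_mono)
  finally show ?case by simp
qed simp

lemma foldr_push_inverse: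
  "reduced w \<Longrightarrow> foldr push (rev (map inv_letter u)) (foldr push u w) = w"
proof (induction u arbitrary: w)
  case (Cons l u)
  then show ?case
    using push_push_inv[OF reduced_foldr_push[OF Cons.prems, of u], of "inv_letter l"] by simp
qed simp

lemma group_free_group: "group (free_group S)"
proof (rule groupI)
  fix u v w assume *: "u \<in> carrier (free_group S)" "v \<in> carrier (free_group S)"
    "w \<in> carrier (free_group S)"
  then show "u \<otimes>\<^bsub>free_group S\<^esub> v \<otimes>\<^bsub>free_group S\<^esub> w
      = u \<otimes>\<^bsub>free_group S\<^esub> (v \<otimes>\<^bsub>free_group S\<^esub> w)"
    by (simp add: free_group_def reduce_append reduced_foldr_push foldr_push_assoc)
next
  fix u v assume "u \<in> carrier (free_group S)" "v \<in> carrier (free_group S)"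
  then show "u \<otimes>\<^bsub>free_group S\<^esub> v \<in> carrier (free_group S)"
    using order_trans[OF gens_foldr_push[of u v], of S]
    by (simp add: free_group_def reduce_append reduced_foldr_push)
next
  fix u assume u: "u \<in> carrier (free_group S)"
  let ?v = "reduce (rev (map inv_letter u))"
  have "fst ` set ?v \<subseteq> S"
    using gens_foldr_push[of "rev (map inv_letter u)" "[]"] u
    by (force simp: free_group_def reduce_def inv_letter_def)
  moreover have "reduced ?v"
    by (simp add: reduce_def reduced_foldr_push)
  moreover have "reduce (?v @ u) = []"
  proof -
    have u': "reduced u" "foldr push u [] = u"
      using u reduce_reduced by (auto simp: free_group_def reduce_def)
    have "foldr push ?v u = foldr push (rev (map inv_letter u)) (foldr push u [])"
      using u' foldr_push_assoc[of u "rev (map inv_letter u)" "[]"] by (simp add: reduce_def)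
    then show ?thesis using u' foldr_push_inverse[of "[]" u] by (simp add: reduce_append)
  qed
  ultimately show "\<exists>v\<in>carrier (free_group S). v \<otimes>\<^bsub>free_group S\<^esub> u = \<one>\<^bsub>free_group S\<^esub>"
    by (auto simp: free_group_def)
qed (auto simp: free_group_def reduce_reduced)

lemma gen_in_free_group: "a \<in> S \<Longrightarrow> gen a \<in> carrier (free_group S)"
  by (simp add: free_group_def gen_def)

definition commutator :: "('a, 'b) monoid_scheme \<Rightarrow> 'a \<Rightarrow> 'a \<Rightarrow> 'a" where
  "commutator G a b = a \<otimes>\<^bsub>G\<^esub> b \<otimes>\<^bsub>G\<^esub> inv\<^bsub>G\<^esub> a \<otimes>\<^bsub>G\<^esub> inv\<^bsub>G\<^esub> b"

text \<open>The relator of a relation \<open>u = v\<close>.\<close>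

definition relator :: "('a, 'b) monoid_scheme \<Rightarrow> 'a \<Rightarrow> 'a \<Rightarrow> 'a" where
  "relator G u v = u \<otimes>\<^bsub>G\<^esub> inv\<^bsub>G\<^esub> v"


section \<open>Presentations and stable AC-equivalence\<close>

text \<open>
  A presentation is a finite set of free generators, named by natural numbers so that new names
  are always available, together with a tuple of relators in the free group on them.
\<close>

type_synonym presentation = "nat set \<times> nat word list"

definition is_presentation :: "presentation \<Rightarrow> bool" where
  "is_presentation P \<longleftrightarrow> finite (fst P) \<and> set (snd P) \<subseteq> carrier (free_group (fst P))"

text \<open>
  The generating set is part of the data, since the transformations (AC4) and (AC5) change the
  ambient free group. An element of \<open>free_group S\<close> does not involve the generator \<open>n\<close> iff it lies
  in \<open>free_group (S - {n})\<close>. The entry dropped in (AC5) may be at any position.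
\<close>

inductive AC_step :: "presentation \<Rightarrow> presentation \<Rightarrow> bool" where
  AC1: "\<lbrakk>i < length Y; j < length Y; i \<noteq> j\<rbrakk>
    \<Longrightarrow> AC_step (S, Y) (S, Y[i := Y ! i \<otimes>\<^bsub>free_group S\<^esub> Y ! j])"
| AC2: "i < length Y \<Longrightarrow> AC_step (S, Y) (S, Y[i := inv\<^bsub>free_group S\<^esub> (Y ! i)])"
| AC3: "\<lbrakk>i < length Y; g \<in> carrier (free_group S)\<rbrakk>
    \<Longrightarrow> AC_step (S, Y)
          (S, Y[i := g \<otimes>\<^bsub>free_group S\<^esub> Y ! i \<otimes>\<^bsub>free_group S\<^esub> inv\<^bsub>free_group S\<^esub> g])"
| AC4: "n \<notin> S \<Longrightarrow> AC_step (S, Y) (insert n S, Y @ [gen n])"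
| AC5: "\<lbrakk>n \<in> S; i < length Y; Y ! i = gen n;
      \<And>j. \<lbrakk>j < length Y; j \<noteq> i\<rbrakk> \<Longrightarrow> Y ! j \<in> carrier (free_group (S - {n}))\<rbrakk>
    \<Longrightarrow> AC_step (S, Y) (S - {n}, take i Y @ drop (Suc i) Y)"

definition rename :: "(nat \<Rightarrow> nat) \<Rightarrow> presentation \<Rightarrow> presentation" where
  "rename f P = (f ` fst P, map (map (apfst f)) (snd P))"

text \<open>
  Since (AC4) and (AC5) can exchange generators, the second presentation is only required to be
  reached up to an injective renaming of its generators.
\<close>

definition stably_AC_equivalent :: "presentation \<Rightarrow> presentation \<Rightarrow> bool" where
  "stably_AC_equivalent P Q \<longleftrightarrow> is_presentation P \<and> is_presentation Q \<and>
    (\<exists>f. inj_on f (fst Q) \<and> AC_step\<^sup>*\<^sup>* P (rename f Q))"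

end

theory Submission
  imports Defs "HOL-Algebra.Coset"
begin

text \<open>
  Put \<open>t = (xy)\<inverse>\<close> and \<open>z = y\<^sup>3\<close>. The braid relation says \<open>t y = x t\<close>, or \<open>t\<^sup>2 = y\<inverse> t y\<inverse>\<close>, so
  \<open>x\<^sup>3 = y\<^sup>4\<close> becomes \<open>t y\<^sup>3 t\<inverse> = y\<^sup>4\<close>. Conjugating this by \<open>y\<inverse>\<close> and using the formula for \<open>t\<^sup>2\<close> gives
  \<open>t\<^sup>2 z t\<^sup>-\<^sup>2 = y z\<close>, that is \<open>y = [t\<^sup>2, z]\<close>. Then \<open>z = y\<^sup>3\<close> is the relation \<open>z = [t\<^sup>2, z]\<^sup>3\<close>, and
  \<open>z t\<^sup>2 z\<inverse> = y\<inverse> t\<^sup>2\<close> turns \<open>t\<^sup>2 = y\<inverse> t y\<inverse>\<close> into the other target relation in \<open>t\<close> and \<open>z\<close>.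
  The transformations do not include automorphisms of the free group, so introducing \<open>t\<close> and \<open>z\<close>
  and removing \<open>x\<close> and \<open>y\<close> relies on both presentations defining the trivial group:
  every word is then a product of conjugates of the relators.
\<close>

section \<open>Computations in groups\<close>

context group
begin

lemma inv_mult_cancel: "\<lbrakk>a \<in> carrier G; b \<in> carrier G\<rbrakk> \<Longrightarrow> inv a \<otimes> (a \<otimes> b) = b"
  by (simp add: m_assoc[symmetric])

lemma mult_inv_cancel: "\<lbrakk>a \<in> carrier G; b \<in> carrier G\<rbrakk> \<Longrightarrow> a \<otimes> (inv a \<otimes> b) = b"
  by (simp add: m_assoc[symmetric])

lemmas word_simps = m_assoc inv_mult_group inv_mult_cancel mult_inv_cancel

lemma relator_closed [simp]:
  "\<lbrakk>a \<in> carrier G; b \<in> carrier G\<rbrakk> \<Longrightarrow> relator G a b \<in> carrier G"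
  by (simp add: relator_def)

lemma commutator_closed [simp]:
  "\<lbrakk>a \<in> carrier G; b \<in> carrier G\<rbrakk> \<Longrightarrow> commutator G a b \<in> carrier G"
  by (simp add: commutator_def)

lemma relator_eq_one_iff:
  assumes "a \<in> carrier G" "b \<in> carrier G"
  shows "relator G a b = \<one> \<longleftrightarrow> a = b"
  using assms inv_solve_right'[of \<one> a b] by (auto simp: relator_def)

lemma pow_intertwine:
  assumes "d \<in> carrier G" "a \<in> carrier G" "b \<in> carrier G" "d \<otimes> a = b \<otimes> d"
  shows "d \<otimes> a [^] (n::nat) = b [^] n \<otimes> d"
proof (induction n)
  case (Suc n)
  have "d \<otimes> a [^] Suc n = b [^] n \<otimes> (d \<otimes> a)"
    using Suc assms(1-3) by (simp add: m_assoc[symmetric])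
  then show ?case using assms by (simp add: m_assoc)
qed (use assms in simp)

text \<open>The element \<open>d = xyx\<close> exchanges \<open>x\<close> and \<open>y\<close> under
  conjugation, so x^3 = y^4 also gives y^3 = x^4. Then y^3 = x x^3 = x y^4 = (xy) y^3 forces xy = 1.
  The braid relation now yields x = y, and x^3 = x^4 finishes.\<close>

lemma AK3_trivial:
  assumes xy: "x \<in> carrier G" "y \<in> carrier G"
    and r1: "x [^] (3::nat) = y [^] (4::nat)" and r2: "x \<otimes> y \<otimes> x = y \<otimes> x \<otimes> y"
  shows "x = \<one>" "y = \<one>"
proof -
  define d where "d = x \<otimes> y \<otimes> x"
  have d: "d \<in> carrier G" using xy by (simp add: d_def)
  have dx: "d \<otimes> x = y \<otimes> d" unfolding d_def using xy r2 by (metis m_assoc m_closed)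
  have dy: "d \<otimes> y = x \<otimes> d" unfolding d_def using xy r2 by (metis m_assoc m_closed)
  have "y [^] (3::nat) \<otimes> d = x [^] (4::nat) \<otimes> d"
    using pow_intertwine[OF d _ _ dx, of 3] pow_intertwine[OF d _ _ dy, of 4] xy r1 by simp
  then have y3: "y [^] (3::nat) = x [^] (4::nat)" using d xy by simp
  have "\<one> \<otimes> y [^] (3::nat) = x [^] (1::nat) \<otimes> x [^] (3::nat)"
    using xy y3 by (subst nat_pow_mult) simp_all
  also have "\<dots> = x \<otimes> (y [^] (1::nat) \<otimes> y [^] (3::nat))"
    using xy r1 by (subst nat_pow_mult) simp_all
  also have "\<dots> = x \<otimes> y \<otimes> y [^] (3::nat)" using xy by (simp add: m_assoc)
  finally have "\<one> = x \<otimes> y" using xy by simp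
  then have eq: "x = y" using r2 xy by (metis l_one m_assoc r_one)
  have "\<one> \<otimes> x [^] (3::nat) = x [^] (1::nat) \<otimes> x [^] (3::nat)"
    using xy r1 eq by (subst nat_pow_mult) simp_all
  then show "x = \<one>" using xy by simp
  then show "y = \<one>" using eq by simp
qed

text \<open>The braid relation says that conjugation by \<open>xy\<close> carries \<open>x\<close>
  to \<open>y\<close>; its inverse \<open>t\<close> therefore carries \<open>y\<close> to
  \<open>x\<close>. Moving one \<open>y\<close> through \<open>t\<close> in t t y y^-1 and using t x
  = y^-1 gives the formula for the square.\<close>

lemma braid_relator:
  assumes "x \<in> carrier G" "y \<in> carrier G" "t \<in> carrier G"
    and "x \<otimes> y \<otimes> x = y \<otimes> x \<otimes> y" "t \<otimes> x \<otimes> y = \<one>"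
  shows "t \<otimes> y = x \<otimes> t" "t \<otimes> t = inv y \<otimes> t \<otimes> inv y"
proof -
  have "inv (x \<otimes> y) = t"
    using assms by (intro inv_equality) (simp_all add: m_assoc)
  then have t: "t = inv y \<otimes> inv x" using assms by (simp add: inv_mult_group)
  have "x \<otimes> y \<otimes> x \<otimes> inv y \<otimes> inv x = y \<otimes> x \<otimes> y \<otimes> inv y \<otimes> inv x"
    using assms(4) by simp
  also have "\<dots> = y" using assms(1,2) by (simp add: word_simps)
  finally have "x \<otimes> y \<otimes> x \<otimes> inv y \<otimes> inv x = y" .
  then have "x \<otimes> y \<otimes> (x \<otimes> t) = x \<otimes> y \<otimes> (t \<otimes> y)"
    using assms(1,2) t by (simp add: word_simps)
  then show ty: "t \<otimes> y = x \<otimes> t" using assms(1-3) by simp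
  have "t \<otimes> t = t \<otimes> t \<otimes> y \<otimes> inv y" using assms by (simp add: word_simps)
  also have "\<dots> = t \<otimes> x \<otimes> t \<otimes> inv y" using assms ty by (simp add: m_assoc)
  also have "t \<otimes> x = inv y" using assms t by (simp add: word_simps)
  finally show "t \<otimes> t = inv y \<otimes> t \<otimes> inv y" .
qed

text \<open>This eliminates \<open>x\<close> from the relation x^3 = y^4 in favour of
  \<open>t\<close>.\<close>

lemma third_power_conjugate:
  assumes "x \<in> carrier G" "y \<in> carrier G" "t \<in> carrier G"
    and "x \<otimes> y \<otimes> x = y \<otimes> x \<otimes> y" "t \<otimes> x \<otimes> y = \<one>"
  shows "x [^] (3::nat) = t \<otimes> y [^] (3::nat) \<otimes> inv t"
  using pow_intertwine[OF _ _ _ braid_relator(1)[OF assms], of 3] assms(1-3)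
  by (simp add: m_assoc)

text \<open>After substituting t^2 = y^-1 t y^-1, the inner powers of \<open>y\<close> commute with
  y^3, and both sides become y^-1 t y^3 t^-1 y^-3. Equality of the elements is what
  \<open>AC_replace\<close> asks for; that both relators vanish together would be too weak.\<close>

lemma conjugate_eq_commutator:
  assumes "x \<in> carrier G" "y \<in> carrier G" "t \<in> carrier G"
    and "x \<otimes> y \<otimes> x = y \<otimes> x \<otimes> y" "t \<otimes> x \<otimes> y = \<one>"
  shows "inv y \<otimes> relator G (t \<otimes> y [^] (3::nat) \<otimes> inv t) (y [^] (4::nat)) \<otimes> inv (inv y)
    = relator G (commutator G (t [^] (2::nat)) (y [^] (3::nat))) y"
proof -
  have "commutator G (t [^] (2::nat)) (y [^] (3::nat))
      = (t \<otimes> t) \<otimes> y [^] (3::nat) \<otimes> inv (t \<otimes> t) \<otimes> inv (y [^] (3::nat))"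
    using assms(3) by (simp add: commutator_def eval_nat_numeral)
  then show ?thesis
    unfolding braid_relator(2)[OF assms] using assms(1-3)
    by (simp add: relator_def word_simps eval_nat_numeral)
qed

text \<open>The commutator formula for \<open>y\<close> rewrites z t^2 z^-1 as y^-1 t^2. With x =
  t^-1 y^-1, both sides become t^2 y t^-1 y.\<close>

lemma conjugate_eq_target_relator:
  assumes "x \<in> carrier G" "y \<in> carrier G" "t \<in> carrier G" "z \<in> carrier G"
    and txy: "t \<otimes> x \<otimes> y = \<one>" and y: "commutator G (t [^] (2::nat)) z = y"
  shows "t [^] (2::nat) \<otimes> inv (relator G (x \<otimes> y \<otimes> x) (y \<otimes> x \<otimes> y)) \<otimes> inv (t [^] (2::nat))
    = relator G (t [^] (4::nat))
        (z \<otimes> t [^] (2::nat) \<otimes> inv z \<otimes> inv t \<otimes> z \<otimes> t [^] (2::nat) \<otimes> inv z)"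
proof -
  have "inv (x \<otimes> y) = t"
    using assms by (intro inv_equality) (simp_all add: m_assoc)
  then have "inv t = x \<otimes> y" using assms(1,2) inv_inv by blast
  then have x: "x = inv t \<otimes> inv y" using assms(1-4) by (simp add: word_simps)
  have a: "z \<otimes> t [^] (2::nat) \<otimes> inv z = inv y \<otimes> t \<otimes> t"
    unfolding y[symmetric] using assms(3,4)
    by (simp add: commutator_def word_simps eval_nat_numeral)
  have "z \<otimes> t [^] (2::nat) \<otimes> inv z \<otimes> inv t \<otimes> z \<otimes> t [^] (2::nat) \<otimes> inv z
      = (z \<otimes> t [^] (2::nat) \<otimes> inv z) \<otimes> inv t \<otimes> (z \<otimes> t [^] (2::nat) \<otimes> inv z)"
    using assms(3,4) by (simp add: m_assoc)
  then show ?thesis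
    unfolding a x using assms(2,3) by (simp add: relator_def word_simps eval_nat_numeral)
qed

text \<open>The passage from \<open>x\<close>, \<open>y\<close> to \<open>t\<close>,
  \<open>z\<close> is undone: y = [t^2, z] and x = t^-1 y^-1 are shown to satisfy the relations of
  \<open>AK3_trivial\<close>.\<close>

lemma target_trivial:
  assumes t: "t \<in> carrier G" and z: "z \<in> carrier G"
    and q1: "t [^] (4::nat)
      = z \<otimes> t [^] (2::nat) \<otimes> inv z \<otimes> inv t \<otimes> z \<otimes> t [^] (2::nat) \<otimes> inv z"
    and q2: "z = commutator G (t [^] (2::nat)) z [^] (3::nat)"
  shows "t = \<one>" "z = \<one>"
proof -
  define y where "y = commutator G (t [^] (2::nat)) z"
  define x where "x = inv t \<otimes> inv y"
  have y: "y \<in> carrier G" using t z by (simp add: y_def)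
  have x: "x \<in> carrier G" using t y by (simp add: x_def)
  have zy: "z = y [^] (3::nat)" using q2 by (simp add: y_def)
  have a: "z \<otimes> t [^] (2::nat) \<otimes> inv z = inv y \<otimes> t \<otimes> t"
    using t z by (simp add: y_def commutator_def word_simps eval_nat_numeral)
  have "t [^] (4::nat) = (z \<otimes> t [^] (2::nat) \<otimes> inv z) \<otimes> inv t \<otimes> (z \<otimes> t [^] (2::nat) \<otimes> inv z)"
    using t z q1 by (simp add: m_assoc)
  also have "\<dots> = (inv y \<otimes> t \<otimes> inv y) \<otimes> (t \<otimes> t)"
    unfolding a using t y by (simp add: word_simps)
  finally have "(t \<otimes> t) \<otimes> (t \<otimes> t) = (inv y \<otimes> t \<otimes> inv y) \<otimes> (t \<otimes> t)"
    using t by (simp add: eval_nat_numeral m_assoc)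
  \<comment> \<open>Cancelling t^2 on the right recovers the formula for the square, which is the
    braid relation in terms of \<open>t\<close> and \<open>y\<close>.\<close>
  then have tt: "t \<otimes> t = inv y \<otimes> t \<otimes> inv y" using t y by simp
  have ty: "t \<otimes> y = x \<otimes> t"
  proof -
    have "x \<otimes> t = inv t \<otimes> (inv y \<otimes> t \<otimes> inv y) \<otimes> y"
      using t y by (simp add: x_def word_simps)
    also have "\<dots> = t \<otimes> y" unfolding tt[symmetric] using t y by (simp add: word_simps)
    finally show ?thesis by simp
  qed
  have "x \<otimes> y \<otimes> x = inv t \<otimes> x" using t y by (simp add: x_def word_simps)
  also have "\<dots> = inv t \<otimes> (x \<otimes> t) \<otimes> inv t" using t x by (simp add: word_simps)
  also have "\<dots> = y \<otimes> inv t" unfolding ty[symmetric] using t y by (simp add: word_simps)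
  also have "\<dots> = y \<otimes> x \<otimes> y" using t y by (simp add: x_def word_simps)
  finally have r2: "x \<otimes> y \<otimes> x = y \<otimes> x \<otimes> y" .
  \<comment> \<open>The definition of \<open>y\<close> says y z = t^2 z t^-2. Inserting the formula
    for t^2, and using that z = y^3 commutes with \<open>y\<close>, gives y z = y^-1 (t z t^-1) y;
    conjugation by \<open>y\<close> turns this into y^4 = x^3.\<close>
  have "y \<otimes> z = t \<otimes> t \<otimes> z \<otimes> inv (t \<otimes> t)"
    using t z by (simp add: y_def commutator_def word_simps eval_nat_numeral)
  also have "\<dots> = inv y \<otimes> t \<otimes> (inv y \<otimes> z \<otimes> y) \<otimes> inv t \<otimes> y"
    unfolding tt using t y z by (simp add: word_simps)
  also have "inv y \<otimes> z \<otimes> y = z" using y by (simp add: zy eval_nat_numeral word_simps)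
  finally have "y \<otimes> (y \<otimes> z) \<otimes> inv y = y \<otimes> (inv y \<otimes> t \<otimes> z \<otimes> inv t \<otimes> y) \<otimes> inv y" by simp
  also have "\<dots> = t \<otimes> z \<otimes> inv t" using t y z by (simp add: word_simps)
  also have "\<dots> = x [^] (3::nat)"
    using pow_intertwine[OF t y x ty, of 3] t x by (simp add: zy word_simps)
  also have "y \<otimes> (y \<otimes> z) \<otimes> inv y = y [^] (4::nat)"
    using y by (simp add: zy eval_nat_numeral word_simps)
  finally have r1: "x [^] (3::nat) = y [^] (4::nat)" by simp
  have xy: "x = \<one>" "y = \<one>" using AK3_trivial[OF x y r1 r2] by auto
  then show "z = \<one>" by (simp add: zy)
  show "t = \<one>" using xy t by (simp add: x_def)
qed

end


section \<open>Homomorphisms and relators\<close>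

context group_hom
begin

lemma hom_relator:
  "\<lbrakk>a \<in> carrier G; b \<in> carrier G\<rbrakk> \<Longrightarrow> h (relator G a b) = relator H (h a) (h b)"
  by (simp add: relator_def)

lemma hom_commutator:
  "\<lbrakk>a \<in> carrier G; b \<in> carrier G\<rbrakk> \<Longrightarrow> h (commutator G a b) = commutator H (h a) (h b)"
  by (simp add: commutator_def)

lemma hom_inv_mult_eq_one:
  "\<lbrakk>a \<in> carrier G; b \<in> carrier G; h a = h b\<rbrakk> \<Longrightarrow> h (inv a \<otimes> b) = \<one>\<^bsub>H\<^esub>"
  by simp

lemmas hom_word_simps = hom_relator hom_commutator hom_nat_pow

end

lemma free_group_inclusion:
  assumes "S \<subseteq> S'" shows "group_hom (free_group S) (free_group S') (\<lambda>w. w)"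
  using assms
  by (intro group_hom.intro group_free_group group_hom_axioms.intro homI)
    (auto simp: free_group_def)

text \<open>Injectivity guarantees that renamed letters cancel only if the original ones do.\<close>

lemma map_apfst_push:
  assumes "inj f"
  shows "map (apfst f) (push l w) = push (apfst f l) (map (apfst f) w)"
proof (cases w)
  case (Cons k v)
  have "apfst f k = inv_letter (apfst f l) \<longleftrightarrow> k = inv_letter l"
    using assms by (cases k; cases l) (auto simp: inv_letter_def inj_eq)
  with Cons show ?thesis by simp
qed simp

lemma map_apfst_reduce:
  assumes "inj f" shows "map (apfst f) (reduce w) = reduce (map (apfst f) w)"
  unfolding reduce_def by (induction w) (simp_all add: map_apfst_push[OF assms])

lemma free_group_rename:
  assumes "inj f"
  shows "group_hom (free_group S) (free_group (f ` S)) (map (apfst f))"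
proof (intro group_hom.intro group_free_group group_hom_axioms.intro homI)
  fix u assume "u \<in> carrier (free_group S)"
  then have u: "reduced u" "fst ` set u \<subseteq> S" by (auto simp: free_group_def)
  \<comment> \<open>Values of \<open>reduce\<close> are always reduced, so a word fixed by
    \<open>reduce\<close> is reduced.\<close>
  have "reduce (map (apfst f) u) = map (apfst f) u"
    using map_apfst_reduce[OF assms, of u] u by (simp add: reduce_reduced)
  then have "reduced (map (apfst f) u)"
    by (metis reduce_def reduced.simps(1) reduced_foldr_push)
  with u show "map (apfst f) u \<in> carrier (free_group (f ` S))"
    by (force simp: free_group_def)
qed (simp add: free_group_def map_apfst_reduce[OF assms])


section \<open>Derived transformations\<close>

text \<open>
  The elements by which the \<open>i\<close>-th entry can be multiplied form a normal subgroup; it contains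
  all other entries. Testing equality modulo this subgroup on arbitrary homomorphisms turns the
  replacement of an entry into an equational consequence of the other relators.
\<close>

lemma AC_replace:
  fixes S :: "nat set"
  defines "F \<equiv> free_group S"
  assumes Y: "set Y \<subseteq> carrier F" and i: "i < length Y" and r': "r' \<in> carrier F"
    and hom: "\<And>(G :: nat word set monoid) h. \<lbrakk>group_hom F G h;
      \<And>j. \<lbrakk>j < length Y; j \<noteq> i\<rbrakk> \<Longrightarrow> h (Y ! j) = \<one>\<^bsub>G\<^esub>\<rbrakk> \<Longrightarrow> h (Y ! i) = h r'"
  shows "AC_step\<^sup>*\<^sup>* (S, Y) (S, Y[i := r'])"
proof -
  interpret F: group F unfolding F_def by (rule group_free_group)
  define R where "R r s = AC_step\<^sup>*\<^sup>* (S, Y[i := r]) (S, Y[i := s])" for r s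
  have trans: "R r s \<Longrightarrow> R s t \<Longrightarrow> R r t" for r s t
    unfolding R_def by (rule rtranclp_trans)
  have conj: "R r (g \<otimes>\<^bsub>F\<^esub> r \<otimes>\<^bsub>F\<^esub> inv\<^bsub>F\<^esub> g)" if "g \<in> carrier F" for r g
    using AC_step.AC3[of i "Y[i := r]" g S] i that by (auto simp: R_def F_def)
  \<comment> \<open>Including the condition for the inverse makes closure under inverses immediate.
    Quantifying over every \<open>r\<close> lets moves be composed although the entry changes on the
    way.\<close>
  define N where "N = {n \<in> carrier F. \<forall>r \<in> carrier F.
    R r (r \<otimes>\<^bsub>F\<^esub> n) \<and> R r (r \<otimes>\<^bsub>F\<^esub> inv\<^bsub>F\<^esub> n)}"
  have "subgroup N F"
  proof (rule F.subgroupI)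
    have "\<one>\<^bsub>F\<^esub> \<in> N" by (auto simp: N_def R_def)
    then show "N \<noteq> {}" by auto
    fix m n assume mn: "m \<in> N" "n \<in> N"
    then have c: "m \<in> carrier F" "n \<in> carrier F" by (auto simp: N_def)
    show "m \<otimes>\<^bsub>F\<^esub> n \<in> N"
      unfolding N_def
    proof (intro CollectI conjI ballI)
      fix r assume r: "r \<in> carrier F"
      have "R r (r \<otimes>\<^bsub>F\<^esub> m)" and "R (r \<otimes>\<^bsub>F\<^esub> m) (r \<otimes>\<^bsub>F\<^esub> m \<otimes>\<^bsub>F\<^esub> n)"
        using mn r c by (simp_all add: N_def)
      from trans[OF this] show "R r (r \<otimes>\<^bsub>F\<^esub> (m \<otimes>\<^bsub>F\<^esub> n))"
        using r c by (simp add: F.m_assoc)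
      let ?s = "r \<otimes>\<^bsub>F\<^esub> inv\<^bsub>F\<^esub> n"
      have "R r ?s" and "R ?s (?s \<otimes>\<^bsub>F\<^esub> inv\<^bsub>F\<^esub> m)"
        using mn r c by (simp_all add: N_def)
      from trans[OF this] show "R r (r \<otimes>\<^bsub>F\<^esub> inv\<^bsub>F\<^esub> (m \<otimes>\<^bsub>F\<^esub> n))"
        using r c by (simp add: F.inv_mult_group F.m_assoc)
    qed (use c in simp)
  qed (auto simp: N_def)
  then have normal: "N \<lhd> F"
  proof (rule F.normal_invI)
    fix g n assume g: "g \<in> carrier F" and n: "n \<in> N"
    then have c: "n \<in> carrier F" by (auto simp: N_def)
    \<comment> \<open>To multiply by a conjugate of \<open>m\<close>, conjugate the entry by g^-1,
      multiply by \<open>m\<close>, and conjugate back by \<open>g\<close>.\<close>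
    have move: "R r (r \<otimes>\<^bsub>F\<^esub> (g \<otimes>\<^bsub>F\<^esub> m \<otimes>\<^bsub>F\<^esub> inv\<^bsub>F\<^esub> g))"
      if r: "r \<in> carrier F" and m: "m \<in> carrier F"
        and "\<And>s. s \<in> carrier F \<Longrightarrow> R s (s \<otimes>\<^bsub>F\<^esub> m)" for r m
    proof -
      let ?s = "inv\<^bsub>F\<^esub> g \<otimes>\<^bsub>F\<^esub> r \<otimes>\<^bsub>F\<^esub> g"
      have s: "R r ?s" using conj[of "inv\<^bsub>F\<^esub> g" r] g by simp
      have sm: "R ?s (?s \<otimes>\<^bsub>F\<^esub> m)" using that g by simp
      have "R (?s \<otimes>\<^bsub>F\<^esub> m) (g \<otimes>\<^bsub>F\<^esub> (?s \<otimes>\<^bsub>F\<^esub> m) \<otimes>\<^bsub>F\<^esub> inv\<^bsub>F\<^esub> g)"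
        by (rule conj[OF g])
      moreover have "g \<otimes>\<^bsub>F\<^esub> (?s \<otimes>\<^bsub>F\<^esub> m) \<otimes>\<^bsub>F\<^esub> inv\<^bsub>F\<^esub> g
          = r \<otimes>\<^bsub>F\<^esub> (g \<otimes>\<^bsub>F\<^esub> m \<otimes>\<^bsub>F\<^esub> inv\<^bsub>F\<^esub> g)"
        using g r m by (simp add: F.word_simps)
      ultimately show ?thesis using trans[OF trans[OF s sm]] by simp
    qed
    have "inv\<^bsub>F\<^esub> (g \<otimes>\<^bsub>F\<^esub> n \<otimes>\<^bsub>F\<^esub> inv\<^bsub>F\<^esub> g) = g \<otimes>\<^bsub>F\<^esub> inv\<^bsub>F\<^esub> n \<otimes>\<^bsub>F\<^esub> inv\<^bsub>F\<^esub> g"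
      using g c by (simp add: F.word_simps)
    then show "g \<otimes>\<^bsub>F\<^esub> n \<otimes>\<^bsub>F\<^esub> inv\<^bsub>F\<^esub> g \<in> N"
      using g c n move[of _ n] move[of _ "inv\<^bsub>F\<^esub> n"] by (simp add: N_def)
  qed
  have others: "Y ! j \<in> N" if j: "j < length Y" "j \<noteq> i" for j
  proof -
    have c: "Y ! j \<in> carrier F" using Y j by auto
    moreover have "R r (r \<otimes>\<^bsub>F\<^esub> Y ! j)" for r
      using AC_step.AC1[of i "Y[i := r]" j S] i j by (auto simp: R_def F_def)
    \<comment> \<open>The \<open>j\<close>-th entry is inverted temporarily, multiplied onto the
      \<open>i\<close>-th, and then restored.\<close>
    moreover have "R r (r \<otimes>\<^bsub>F\<^esub> inv\<^bsub>F\<^esub> (Y ! j))" for r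
    proof -
      let ?u = "inv\<^bsub>F\<^esub> (Y ! j)"
      let ?r = "r \<otimes>\<^bsub>F\<^esub> ?u"
      have "AC_step (S, Y[i := r]) (S, Y[i := r, j := ?u])"
        using AC_step.AC2[of j "Y[i := r]" S] j by (simp add: F_def)
      moreover have "AC_step (S, Y[i := r, j := ?u]) (S, Y[i := ?r, j := ?u])"
        using AC_step.AC1[of i "Y[i := r, j := ?u]" j S] i j
        by (simp add: F_def list_update_swap[of i j])
      moreover have "AC_step (S, Y[i := ?r, j := ?u]) (S, Y[i := ?r])"
        using AC_step.AC2[of j "Y[i := ?r, j := ?u]" S] j c
        by (simp add: F_def group.inv_inv[OF group_free_group] list_update_swap[of i j] list_update_id)
      ultimately show ?thesis unfolding R_def by (meson r_into_rtranclp rtranclp.rtrancl_into_rtrancl)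
    qed
    ultimately show ?thesis by (simp add: N_def)
  qed
  interpret N: normal N F by (rule normal)
  \<comment> \<open>The quotient map is the homomorphism to which \<open>hom\<close> is applied; its
    values are cosets, hence the type \<open>nat word set monoid\<close> there.\<close>
  interpret q: group_hom F "F Mod N" "\<lambda>a. N #>\<^bsub>F\<^esub> a"
    by (intro group_hom.intro group_hom_axioms.intro F.group_axioms N.factorgroup_is_group
        N.r_coset_hom_Mod)
  have ri: "Y ! i \<in> carrier F" using Y i by auto
  have "N #>\<^bsub>F\<^esub> Y ! i = N #>\<^bsub>F\<^esub> r'"
  proof (rule hom[OF q.group_hom_axioms])
    fix j assume "j < length Y" "j \<noteq> i"
    then show "N #>\<^bsub>F\<^esub> Y ! j = \<one>\<^bsub>F Mod N\<^esub>"
      using others N.rcos_const by (simp add: FactGroup_def)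
  qed
  with ri r' have "N #>\<^bsub>F\<^esub> (inv\<^bsub>F\<^esub> (Y ! i) \<otimes>\<^bsub>F\<^esub> r') = \<one>\<^bsub>F Mod N\<^esub>"
    by (rule q.hom_inv_mult_eq_one)
  then have "inv\<^bsub>F\<^esub> (Y ! i) \<otimes>\<^bsub>F\<^esub> r' \<in> N"
    using F.rcos_self[of "inv\<^bsub>F\<^esub> (Y ! i) \<otimes>\<^bsub>F\<^esub> r'" N] N.subgroup_axioms ri r'
    by (simp add: FactGroup_def)
  \<comment> \<open>Equal cosets put the quotient of the old and the new entry into
    \<open>N\<close>, so one admissible multiplication produces \<open>r'\<close>.\<close>
  then have "R (Y ! i) (Y ! i \<otimes>\<^bsub>F\<^esub> (inv\<^bsub>F\<^esub> (Y ! i) \<otimes>\<^bsub>F\<^esub> r'))"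
    using ri unfolding N_def by blast
  then show ?thesis unfolding R_def using F.mult_inv_cancel[OF ri r'] by simp
qed

theorem proposition1p2:
  fixes F :: "nat word monoid" (structure) and x y :: "nat word"
  defines "F \<equiv> free_group {0, 1}" and "x \<equiv> gen 0" and "y \<equiv> gen 1"
  shows "stably_AC_equivalent
    ({0, 1},
     [relator F (x [^] (3::nat)) (y [^] (4::nat)),
      relator F (x \<otimes> y \<otimes> x) (y \<otimes> x \<otimes> y)])
    ({0, 1},
     [relator F (x [^] (4::nat))
        (y \<otimes> x [^] (2::nat) \<otimes> inv y \<otimes> inv x \<otimes> y \<otimes> x [^] (2::nat) \<otimes> inv y),
      relator F y (commutator F (x [^] (2::nat)) y [^] (3::nat))])"
proof -
  interpret F: group F unfolding F_def by (rule group_free_group)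
  have xyF: "x \<in> carrier F" "y \<in> carrier F"
    by (simp_all add: F_def x_def y_def gen_in_free_group)
  \<comment> \<open>The names 0 and 1 belong to \<open>x\<close> and \<open>y\<close>; 2 and 3 are
    introduced for \<open>t\<close> and \<open>z\<close> and are the ones that survive.\<close>
  define U :: "nat set" where "U = {0, 1, 2, 3}"
  define E where "E = free_group U"
  define t z :: "nat word" where "t = gen 2" and "z = gen 3"
  interpret E: group E unfolding E_def by (rule group_free_group)
  have gens [simp]: "x \<in> carrier E" "y \<in> carrier E" "t \<in> carrier E" "z \<in> carrier E"
    by (simp_all add: E_def U_def x_def y_def t_def z_def gen_in_free_group)

  \<comment> \<open>Relators occurring along the chain\<close>
  define p1 where "p1 = relator E (x [^]\<^bsub>E\<^esub> (3::nat)) (y [^]\<^bsub>E\<^esub> (4::nat))"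
  define p2 where "p2 = relator E (x \<otimes>\<^bsub>E\<^esub> y \<otimes>\<^bsub>E\<^esub> x) (y \<otimes>\<^bsub>E\<^esub> x \<otimes>\<^bsub>E\<^esub> y)"
  define q1 where "q1 = relator E (t [^]\<^bsub>E\<^esub> (4::nat)) (z \<otimes>\<^bsub>E\<^esub> t [^]\<^bsub>E\<^esub> (2::nat) \<otimes>\<^bsub>E\<^esub> inv\<^bsub>E\<^esub> z
    \<otimes>\<^bsub>E\<^esub> inv\<^bsub>E\<^esub> t \<otimes>\<^bsub>E\<^esub> z \<otimes>\<^bsub>E\<^esub> t [^]\<^bsub>E\<^esub> (2::nat) \<otimes>\<^bsub>E\<^esub> inv\<^bsub>E\<^esub> z)"
  define q2 where "q2 = relator E z (commutator E (t [^]\<^bsub>E\<^esub> (2::nat)) z [^]\<^bsub>E\<^esub> (3::nat))"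
  define rt where "rt = t \<otimes>\<^bsub>E\<^esub> x \<otimes>\<^bsub>E\<^esub> y"
  define rz where "rz = relator E z (y [^]\<^bsub>E\<^esub> (3::nat))"
  \<comment> \<open>\<open>c\<close> is \<open>p1\<close> with x^3 rewritten through
    \<open>t\<close>. The conjugates \<open>c'\<close> and \<open>p2'\<close> are chosen so that
    they agree with \<open>ry\<close> and \<open>q1\<close> modulo the other relators.\<close>
  define c where "c = relator E (t \<otimes>\<^bsub>E\<^esub> y [^]\<^bsub>E\<^esub> (3::nat) \<otimes>\<^bsub>E\<^esub> inv\<^bsub>E\<^esub> t) (y [^]\<^bsub>E\<^esub> (4::nat))"
  define c' where "c' = inv\<^bsub>E\<^esub> y \<otimes>\<^bsub>E\<^esub> c \<otimes>\<^bsub>E\<^esub> inv\<^bsub>E\<^esub> (inv\<^bsub>E\<^esub> y)"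
  define ry where "ry = relator E (commutator E (t [^]\<^bsub>E\<^esub> (2::nat)) z) y"
  define p2' where "p2' = t [^]\<^bsub>E\<^esub> (2::nat) \<otimes>\<^bsub>E\<^esub> inv\<^bsub>E\<^esub> p2 \<otimes>\<^bsub>E\<^esub> inv\<^bsub>E\<^esub> (t [^]\<^bsub>E\<^esub> (2::nat))"
  note defs = p1_def p2_def q1_def q2_def rt_def rz_def c_def c'_def ry_def p2'_def
  have closed [simp]: "p1 \<in> carrier E" "p2 \<in> carrier E" "q1 \<in> carrier E" "q2 \<in> carrier E"
    "rt \<in> carrier E" "rz \<in> carrier E" "c \<in> carrier E" "c' \<in> carrier E" "ry \<in> carrier E"
    "p2' \<in> carrier E"
    by (simp_all add: defs)

  \<comment> \<open>Replacing one entry of a four-term tuple\<close>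
  have replace: "AC_step\<^sup>*\<^sup>* (U, L) (U, L[i := r])"
    if "set L \<subseteq> carrier E" "i < length L" "r \<in> carrier E"
      "\<And>(G :: nat word set monoid) h. \<lbrakk>group_hom E G h;
        \<And>j. \<lbrakk>j < length L; j \<noteq> i\<rbrakk> \<Longrightarrow> h (L ! j) = \<one>\<^bsub>G\<^esub>\<rbrakk> \<Longrightarrow> h (L ! i) = h r"
    for L i r
    using AC_replace[of L U i r] that unfolding E_def by blast
  have replace0: "AC_step\<^sup>*\<^sup>* (U, [u0, u1, u2, u3]) (U, [r, u1, u2, u3])"
    if "set [u0, u1, u2, u3, r] \<subseteq> carrier E"
      "\<And>(G :: nat word set monoid) h. \<lbrakk>group_hom E G h; h u1 = \<one>\<^bsub>G\<^esub>; h u2 = \<one>\<^bsub>G\<^esub>; h u3 = \<one>\<^bsub>G\<^esub>\<rbrakk>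
        \<Longrightarrow> h u0 = h r"
    for u0 u1 u2 u3 r
  proof -
    have "AC_step\<^sup>*\<^sup>* (U, [u0, u1, u2, u3]) (U, [u0, u1, u2, u3][0 := r])"
    proof (rule replace)
      fix G :: "nat word set monoid" and h
      assume "group_hom E G h" and others: "\<And>j. \<lbrakk>j < length [u0, u1, u2, u3]; j \<noteq> 0\<rbrakk>
        \<Longrightarrow> h ([u0, u1, u2, u3] ! j) = \<one>\<^bsub>G\<^esub>"
      then show "h ([u0, u1, u2, u3] ! 0) = h r"
        using that(2)[of G h] others[of 1] others[of 2] others[of 3] by simp
    qed (use that(1) in simp_all)
    then show ?thesis by (simp add: eval_nat_numeral)
  qed
  have replace1: "AC_step\<^sup>*\<^sup>* (U, [u0, u1, u2, u3]) (U, [u0, r, u2, u3])"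
    if "set [u0, u1, u2, u3, r] \<subseteq> carrier E"
      "\<And>(G :: nat word set monoid) h. \<lbrakk>group_hom E G h; h u0 = \<one>\<^bsub>G\<^esub>; h u2 = \<one>\<^bsub>G\<^esub>; h u3 = \<one>\<^bsub>G\<^esub>\<rbrakk>
        \<Longrightarrow> h u1 = h r"
    for u0 u1 u2 u3 r
  proof -
    have "AC_step\<^sup>*\<^sup>* (U, [u0, u1, u2, u3]) (U, [u0, u1, u2, u3][1 := r])"
    proof (rule replace)
      fix G :: "nat word set monoid" and h
      assume "group_hom E G h" and others: "\<And>j. \<lbrakk>j < length [u0, u1, u2, u3]; j \<noteq> 1\<rbrakk>
        \<Longrightarrow> h ([u0, u1, u2, u3] ! j) = \<one>\<^bsub>G\<^esub>"
      then show "h ([u0, u1, u2, u3] ! 1) = h r"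
        using that(2)[of G h] others[of 0] others[of 2] others[of 3] by simp
    qed (use that(1) in simp_all)
    then show ?thesis by (simp add: eval_nat_numeral)
  qed
  have replace2: "AC_step\<^sup>*\<^sup>* (U, [u0, u1, u2, u3]) (U, [u0, u1, r, u3])"
    if "set [u0, u1, u2, u3, r] \<subseteq> carrier E"
      "\<And>(G :: nat word set monoid) h. \<lbrakk>group_hom E G h; h u0 = \<one>\<^bsub>G\<^esub>; h u1 = \<one>\<^bsub>G\<^esub>; h u3 = \<one>\<^bsub>G\<^esub>\<rbrakk>
        \<Longrightarrow> h u2 = h r"
    for u0 u1 u2 u3 r
  proof -
    have "AC_step\<^sup>*\<^sup>* (U, [u0, u1, u2, u3]) (U, [u0, u1, u2, u3][2 := r])"
    proof (rule replace)
      fix G :: "nat word set monoid" and h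
      assume "group_hom E G h" and others: "\<And>j. \<lbrakk>j < length [u0, u1, u2, u3]; j \<noteq> 2\<rbrakk>
        \<Longrightarrow> h ([u0, u1, u2, u3] ! j) = \<one>\<^bsub>G\<^esub>"
      then show "h ([u0, u1, u2, u3] ! 2) = h r"
        using that(2)[of G h] others[of 0] others[of 1] others[of 3] by simp
    qed (use that(1) in simp_all)
    then show ?thesis by (simp add: eval_nat_numeral)
  qed
  have replace3: "AC_step\<^sup>*\<^sup>* (U, [u0, u1, u2, u3]) (U, [u0, u1, u2, r])"
    if "set [u0, u1, u2, u3, r] \<subseteq> carrier E"
      "\<And>(G :: nat word set monoid) h. \<lbrakk>group_hom E G h; h u0 = \<one>\<^bsub>G\<^esub>; h u1 = \<one>\<^bsub>G\<^esub>; h u2 = \<one>\<^bsub>G\<^esub>\<rbrakk>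
        \<Longrightarrow> h u3 = h r"
    for u0 u1 u2 u3 r
  proof -
    have "AC_step\<^sup>*\<^sup>* (U, [u0, u1, u2, u3]) (U, [u0, u1, u2, u3][3 := r])"
    proof (rule replace)
      fix G :: "nat word set monoid" and h
      assume "group_hom E G h" and others: "\<And>j. \<lbrakk>j < length [u0, u1, u2, u3]; j \<noteq> 3\<rbrakk>
        \<Longrightarrow> h ([u0, u1, u2, u3] ! j) = \<one>\<^bsub>G\<^esub>"
      then show "h ([u0, u1, u2, u3] ! 3) = h r"
        using that(2)[of G h] others[of 0] others[of 1] others[of 2] by simp
    qed (use that(1) in simp_all)
    then show ?thesis by (simp add: eval_nat_numeral)
  qed

  \<comment> \<open>Equalities modulo the other relators\<close>
  have h_AK3: "h x = \<one>\<^bsub>G\<^esub>" "h y = \<one>\<^bsub>G\<^esub>"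
    if "group_hom E G h" "h p1 = \<one>\<^bsub>G\<^esub>" "h p2 = \<one>\<^bsub>G\<^esub>" for G :: "nat word set monoid" and h
  proof -
    interpret h: group_hom E G h by fact
    show "h x = \<one>\<^bsub>G\<^esub>" "h y = \<one>\<^bsub>G\<^esub>"
      using h.H.AK3_trivial[of "h x" "h y"] that(2,3)
      by (simp_all add: p1_def p2_def h.hom_word_simps h.H.relator_eq_one_iff)
  qed
  \<comment> \<open>Modulo \<open>p1\<close> and \<open>p2\<close> both \<open>x\<close> and
    \<open>y\<close> vanish, so inserting them into the relators \<open>t\<close> and
    \<open>z\<close> changes nothing.\<close>
  have h_t: "h t = h rt" and h_z: "h z = h rz"
    if "group_hom E G h" "h p1 = \<one>\<^bsub>G\<^esub>" "h p2 = \<one>\<^bsub>G\<^esub>" for G :: "nat word set monoid" and h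
  proof -
    interpret h: group_hom E G h by fact
    show "h t = h rt" "h z = h rz"
      using h_AK3[OF that] by (simp_all add: rt_def rz_def relator_def h.hom_word_simps)
  qed
  have h_c: "h p1 = h c"
    if "group_hom E G h" "h p2 = \<one>\<^bsub>G\<^esub>" "h rt = \<one>\<^bsub>G\<^esub>"
    for G :: "nat word set monoid" and h
  proof -
    interpret h: group_hom E G h by fact
    show ?thesis
      using h.H.third_power_conjugate[of "h x" "h y" "h t"] that(2,3)
      by (simp add: p1_def p2_def c_def rt_def h.hom_word_simps h.H.relator_eq_one_iff)
  qed
  have h_ry: "h c' = h ry"
    if "group_hom E G h" "h p2 = \<one>\<^bsub>G\<^esub>" "h rt = \<one>\<^bsub>G\<^esub>" "h rz = \<one>\<^bsub>G\<^esub>"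
    for G :: "nat word set monoid" and h
  proof -
    interpret h: group_hom E G h by fact
    show ?thesis
      using h.H.conjugate_eq_commutator[of "h x" "h y" "h t"] that(2-4)
      by (simp add: p2_def c_def c'_def rt_def rz_def ry_def h.hom_word_simps
          h.H.relator_eq_one_iff)
  qed
  have h_q1: "h p2' = h q1"
    if "group_hom E G h" "h rt = \<one>\<^bsub>G\<^esub>" "h ry = \<one>\<^bsub>G\<^esub>"
    for G :: "nat word set monoid" and h
  proof -
    interpret h: group_hom E G h by fact
    show ?thesis
      using h.H.conjugate_eq_target_relator[of "h x" "h y" "h t" "h z"] that(2,3)
      by (simp add: p2_def p2'_def q1_def rt_def ry_def h.hom_word_simps
          h.H.relator_eq_one_iff)
  qed
  have h_q2: "h rz = h q2"
    if "group_hom E G h" "h ry = \<one>\<^bsub>G\<^esub>" for G :: "nat word set monoid" and h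
  proof -
    interpret h: group_hom E G h by fact
    show ?thesis
      using that(2) by (simp add: rz_def q2_def ry_def h.hom_word_simps h.H.relator_eq_one_iff)
  qed
  have h_target: "h t = \<one>\<^bsub>G\<^esub>" "h z = \<one>\<^bsub>G\<^esub>"
    if "group_hom E G h" "h q1 = \<one>\<^bsub>G\<^esub>" "h q2 = \<one>\<^bsub>G\<^esub>" for G :: "nat word set monoid" and h
  proof -
    interpret h: group_hom E G h by fact
    show "h t = \<one>\<^bsub>G\<^esub>" "h z = \<one>\<^bsub>G\<^esub>"
      using h.H.target_trivial[of "h t" "h z"] that(2,3)
      by (simp_all add: q1_def q2_def h.hom_word_simps h.H.relator_eq_one_iff)
  qed
  \<comment> \<open>Once \<open>t\<close> and \<open>z\<close> vanish, so does the commutator, and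
    \<open>ry\<close> is left as y^-1; hence the inverse.\<close>
  have h_y: "h (inv\<^bsub>E\<^esub> ry) = h y"
    if "group_hom E G h" "h q1 = \<one>\<^bsub>G\<^esub>" "h q2 = \<one>\<^bsub>G\<^esub>" for G :: "nat word set monoid" and h
  proof -
    interpret h: group_hom E G h by fact
    show ?thesis
      using h_target[OF that] by (simp add: ry_def h.hom_word_simps commutator_def relator_def)
  qed
  have h_x: "h rt = h x"
    if "group_hom E G h" "h q1 = \<one>\<^bsub>G\<^esub>" "h q2 = \<one>\<^bsub>G\<^esub>" "h y = \<one>\<^bsub>G\<^esub>"
    for G :: "nat word set monoid" and h
  proof -
    interpret h: group_hom E G h by fact
    show ?thesis using h_target[OF that(1-3)] that(4) by (simp add: rt_def)
  qed

  text \<open>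
    The inclusion of a free group into a larger one is given the name \<open>k\<close>, because
    homomorphism laws for \<open>\<lambda>w. w\<close> are useless as rewrite rules.
  \<close>

  obtain k :: "nat word \<Rightarrow> nat word" where k: "\<And>w. k w = w" by blast
  then have kw: "k = (\<lambda>w. w)" by auto
  interpret i: group_hom F E k
    unfolding F_def E_def U_def kw by (rule free_group_inclusion) auto
  have "k (relator F (x [^] (3::nat)) (y [^] (4::nat))) = p1"
    "k (relator F (x \<otimes> y \<otimes> x) (y \<otimes> x \<otimes> y)) = p2"
    using xyF by (simp_all add: p1_def p2_def i.hom_word_simps k[of x] k[of y])
  then have P: "relator F (x [^] (3::nat)) (y [^] (4::nat)) = p1"
    "relator F (x \<otimes> y \<otimes> x) (y \<otimes> x \<otimes> y) = p2"
    by (simp_all add: k)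

  \<comment> \<open>The second presentation in the generators \<open>t\<close> and
    \<open>z\<close>\<close>
  define f :: "nat \<Rightarrow> nat" where "f n = n + 2" for n
  have f: "inj f" by (simp add: f_def inj_on_def)
  have fU: "f ` {0, 1} = {2, 3}" by (simp add: f_def numeral_eq_Suc)
  interpret r: group_hom F "free_group {2, 3}" "map (apfst f)"
    unfolding F_def using free_group_rename[OF f, of "{0, 1}"] unfolding fU .
  interpret j: group_hom "free_group {2, 3}" E k
    unfolding E_def U_def kw by (rule free_group_inclusion) auto
  let ?Q1 = "relator F (x [^] (4::nat))
    (y \<otimes> x [^] (2::nat) \<otimes> inv y \<otimes> inv x \<otimes> y \<otimes> x [^] (2::nat) \<otimes> inv y)"
  let ?Q2 = "relator F y (commutator F (x [^] (2::nat)) y [^] (3::nat))"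
  have fxy: "map (apfst f) x = t" "map (apfst f) y = z"
    by (simp_all add: x_def y_def t_def z_def gen_def f_def)
  have tz: "t \<in> carrier (free_group {2, 3})" "z \<in> carrier (free_group {2, 3})"
    by (simp_all add: t_def z_def gen_in_free_group)
  have "k (map (apfst f) ?Q1) = q1" "k (map (apfst f) ?Q2) = q2"
    using xyF tz
    by (simp_all add: r.hom_word_simps j.hom_word_simps fxy k[of t] k[of z] q1_def q2_def)
  then have Q: "map (apfst f) ?Q1 = q1" "map (apfst f) ?Q2 = q2" by (simp_all add: k)
  have "?Q1 \<in> carrier F" "?Q2 \<in> carrier F" using xyF by simp_all
  then have "q1 \<in> carrier (free_group {2, 3})" "q2 \<in> carrier (free_group {2, 3})"
    using Q r.hom_closed by metis+
  \<comment> \<open>This is the non-involvement condition for (AC5): \<open>q1\<close> and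
    \<open>q2\<close> avoid both \<open>x\<close> and \<open>y\<close>.\<close>
  then have q: "q1 \<in> carrier (free_group S)" "q2 \<in> carrier (free_group S)" if "{2, 3} \<subseteq> S" for S
    using that by (auto simp: free_group_def)

  \<comment> \<open>Removal of the generators \<open>y\<close> and \<open>x\<close>\<close>
  have drop_y: "AC_step (U, [y, q1, x, q2]) ({0, 2, 3}, [q1, x, q2])"
  proof -
    have "AC_step (U, [y, q1, x, q2])
      (U - {1}, take 0 [y, q1, x, q2] @ drop (Suc 0) [y, q1, x, q2])"
    proof (rule AC_step.AC5)
      fix j assume "j < length [y, q1, x, q2]" "j \<noteq> 0"
      then have "[y, q1, x, q2] ! j \<in> {q1, x, q2}" by (auto simp: less_Suc_eq)
      moreover have "x \<in> carrier (free_group (U - {1}))"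
        by (simp add: x_def U_def gen_in_free_group)
      ultimately show "[y, q1, x, q2] ! j \<in> carrier (free_group (U - {1}))"
        using q[of "U - {1}"] by (auto simp: U_def)
    qed (simp_all add: U_def y_def)
    moreover have "U - {1} = {0, 2, 3}" by (auto simp: U_def)
    ultimately show ?thesis by simp
  qed
  have drop_x: "AC_step ({0, 2, 3}, [q1, x, q2]) (rename f ({0, 1}, [?Q1, ?Q2]))"
  proof -
    have "AC_step ({0, 2, 3}, [q1, x, q2])
      ({0, 2, 3} - {0}, take (Suc 0) [q1, x, q2] @ drop (Suc (Suc 0)) [q1, x, q2])"
    proof (rule AC_step.AC5)
      fix j assume "j < length [q1, x, q2]" "j \<noteq> Suc 0"
      then have "[q1, x, q2] ! j \<in> {q1, q2}" by (auto simp: less_Suc_eq)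
      then show "[q1, x, q2] ! j \<in> carrier (free_group ({0, 2, 3} - {0}))"
        using q[of "{0, 2, 3} - {0}"] by auto
    qed (simp_all add: x_def)
    moreover have "rename f ({0, 1}, [?Q1, ?Q2]) = ({2, 3}, [q1, q2])"
      unfolding rename_def fst_conv snd_conv fU by (simp add: Q)
    ultimately show ?thesis by simp
  qed

  \<comment> \<open>The chain of transformations\<close>
  have "AC_step ({0, 1}, [p1, p2]) ({0, 1, 2}, [p1, p2, t])"
    using AC_step.AC4[of 2 "{0, 1}" "[p1, p2]"] by (simp add: t_def insert_commute)
  moreover have "AC_step ({0, 1, 2}, [p1, p2, t]) (U, [p1, p2, t, z])"
    using AC_step.AC4[of 3 "{0, 1, 2}" "[p1, p2, t]"] by (simp add: z_def U_def insert_commute)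
  ultimately have "AC_step\<^sup>*\<^sup>* ({0, 1}, [p1, p2]) (U, [p1, p2, t, z])" by simp
  also have "AC_step\<^sup>*\<^sup>* (U, [p1, p2, t, z]) (U, [p1, p2, rt, z])"
    by (rule replace2) (simp_all add: h_t)
  also have "AC_step\<^sup>*\<^sup>* (U, [p1, p2, rt, z]) (U, [p1, p2, rt, rz])"
    by (rule replace3) (simp_all add: h_z)
  also have "AC_step\<^sup>*\<^sup>* (U, [p1, p2, rt, rz]) (U, [c, p2, rt, rz])"
    by (rule replace0) (simp_all add: h_c)
  also have "AC_step\<^sup>*\<^sup>* (U, [c, p2, rt, rz]) (U, [c', p2, rt, rz])"
    using AC_step.AC3[of 0 "[c, p2, rt, rz]" "inv\<^bsub>E\<^esub> y" U, folded E_def]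
    by (auto simp: c'_def)
  also have "AC_step\<^sup>*\<^sup>* (U, [c', p2, rt, rz]) (U, [ry, p2, rt, rz])"
    by (rule replace0) (simp_all add: h_ry)
  \<comment> \<open>Inverting and then conjugating by t^2 brings the braid relator to the form
    \<open>p2'\<close>, which equals \<open>q1\<close> modulo \<open>rt\<close> and
    \<open>ry\<close>.\<close>
  also have "AC_step\<^sup>*\<^sup>* (U, [ry, p2, rt, rz]) (U, [ry, inv\<^bsub>E\<^esub> p2, rt, rz])"
    using AC_step.AC2[of 1 "[ry, p2, rt, rz]" U, folded E_def] by auto
  also have "AC_step\<^sup>*\<^sup>* (U, [ry, inv\<^bsub>E\<^esub> p2, rt, rz]) (U, [ry, p2', rt, rz])"
    using AC_step.AC3[of 1 "[ry, inv\<^bsub>E\<^esub> p2, rt, rz]" "t [^]\<^bsub>E\<^esub> (2::nat)" U, folded E_def]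
    by (auto simp: p2'_def)
  also have "AC_step\<^sup>*\<^sup>* (U, [ry, p2', rt, rz]) (U, [ry, q1, rt, rz])"
    by (rule replace1) (simp_all add: h_q1)
  also have "AC_step\<^sup>*\<^sup>* (U, [ry, q1, rt, rz]) (U, [ry, q1, rt, q2])"
    by (rule replace3) (simp_all add: h_q2)
  \<comment> \<open>With \<open>q1\<close> and \<open>q2\<close> in place, \<open>t\<close> and
    \<open>z\<close> are trivial modulo them. First \<open>ry\<close> is reduced to
    \<open>y\<close>, and only then \<open>rt\<close> to \<open>x\<close>, since the latter also
    needs \<open>y\<close> to vanish.\<close>
  also have "AC_step\<^sup>*\<^sup>* (U, [ry, q1, rt, q2]) (U, [inv\<^bsub>E\<^esub> ry, q1, rt, q2])"
    using AC_step.AC2[of 0 "[ry, q1, rt, q2]" U, folded E_def] by auto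
  also have "AC_step\<^sup>*\<^sup>* (U, [inv\<^bsub>E\<^esub> ry, q1, rt, q2]) (U, [y, q1, rt, q2])"
    by (rule replace0) (simp_all add: h_y)
  also have "AC_step\<^sup>*\<^sup>* (U, [y, q1, rt, q2]) (U, [y, q1, x, q2])"
    by (rule replace2) (simp_all add: h_x)
  finally have "AC_step\<^sup>*\<^sup>* ({0, 1}, [p1, p2]) (U, [y, q1, x, q2])" .
  from this drop_y have "AC_step\<^sup>*\<^sup>* ({0, 1}, [p1, p2]) ({0, 2, 3}, [q1, x, q2])"
    by (rule rtranclp.rtrancl_into_rtrancl)
  from this drop_x have chain: "AC_step\<^sup>*\<^sup>* ({0, 1}, [p1, p2]) (rename f ({0, 1}, [?Q1, ?Q2]))"
    by (rule rtranclp.rtrancl_into_rtrancl)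
  have "is_presentation ({0, 1}, [relator F (x [^] (3::nat)) (y [^] (4::nat)),
      relator F (x \<otimes> y \<otimes> x) (y \<otimes> x \<otimes> y)])" "is_presentation ({0, 1}, [?Q1, ?Q2])"
    unfolding is_presentation_def fst_conv snd_conv F_def[symmetric] using xyF by simp_all
  moreover have "inj_on f {0, 1}" using f by (rule inj_on_subset) simp
  ultimately show ?thesis
    unfolding stably_AC_equivalent_def fst_conv using chain[folded P]
    by (intro conjI exI[of _ f])
qed

end
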